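(* Let $q$ be a prime power, $\mathbb{A}=\mathbb{F}_q[t]$, and let $f,g\in\mathbb{A}$ be non-constant polynomials. Let $g=\alpha P_1^{e_1}\cdots P_r^{e_r}$ be the prime factorization of $g$, where $\alpha\in\mathbb{F}_q^*$, each $e_i\ge 1$, and $P_1,\dots,P_r$ are pairwise distinct monic irreducible polynomials of positive degree over $\mathbb{F}_q$. Then every function $\sigma:\mathbb{A}_f\to\mathbb{A}_g$ is congruence preserving if and only if $\deg f\le\deg P_i$ for every $1\le i\le r$.
   Context: $\mathbb{F}_q$ is the finite field with $q$ elements and $\mathbb{A}=\mathbb{F}_q[t]$. For a non-constant $f\in\mathbb{A}$, $\mathbb{A}_f=\mathbb{A}/f\mathbb{A}$ is the residue class ring modulo $f$, and $\mathcal{A}_f=\{h\in\mathbb{A}:\deg h<\deg f\}\cup\{0\}$, a complete set of representatives of the residue classes modulo $f$; for $h\in\mathcal{A}_f$, $\bar h$ denotes the residue class of $h$ modulo $f$. A function $\sigma:\mathbb{A}_f\to\mathbb{A}_g$ is called congruence preserving if for all $h_1,h_2\in\mathcal{A}_f$ and every $h\in\mathbb{A}$ dividing $g$, $h_1\equiv h_2\pmod h$ implies $\sigma(\bar h_1)\equiv\sigma(\bar h_2)\pmod h$ (here $h_1,h_2$ are regarded as elements of $\mathbb{A}$, and reduction modulo $h$ of elements of $\mathbb{A}_g$ is well defined since $h\mid g$). *)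

theory Defs
  imports
    "HOL-Library.Cardinality"
    "HOL-Library.FuncSet"
    "HOL-Computational_Algebra.Polynomial"
    "HOL-Number_Theory.Cong"
    "HOL-Number_Theory.Prime_Powers"
begin

definition cong_rel :: "'a::field poly \<Rightarrow> ('a poly \<times> 'a poly) set" where
  "cong_rel f = {(a, b). [a = b] (mod f)}"

definition residue_class :: "'a::field poly \<Rightarrow> 'a poly \<Rightarrow> 'a poly set" where
  "residue_class f h = cong_rel f `` {h}"

(* Underlying set of the residue class ring modulo f; the ring operations play no role
   for congruence preservation. *)
definition residue_classes :: "'a::field poly \<Rightarrow> 'a poly set set" where
  "residue_classes f = UNIV // cong_rel f"

definition representatives :: "'a::field poly \<Rightarrow> 'a poly set" where
  "representatives f = {h. degree h < degree f} \<union> {0}"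

(* The canonical reduction map from residue classes modulo g to residue classes modulo h,
   for h dividing g: the class X is sent to the class modulo h that contains it, see
   reduce_residue_class below. *)
definition reduce :: "'a::field poly \<Rightarrow> 'a poly set \<Rightarrow> 'a poly set" where
  "reduce h X = cong_rel h `` X"

definition congruence_preserving ::
  "'a::field poly \<Rightarrow> 'a poly \<Rightarrow> ('a poly set \<Rightarrow> 'a poly set) \<Rightarrow> bool" where
  "congruence_preserving f g \<sigma> \<longleftrightarrow>
    (\<forall>h1\<in>representatives f. \<forall>h2\<in>representatives f. \<forall>h. h dvd g \<longrightarrow>
      [h1 = h2] (mod h) \<longrightarrow>
      reduce h (\<sigma> (residue_class f h1)) = reduce h (\<sigma> (residue_class f h2)))"

lemma equiv_cong_rel: "equiv UNIV (cong_rel f)"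
  by (auto simp: cong_rel_def cong_def intro!: equivI refl_onI symI transI)

lemma residue_classes_eq_range: "residue_classes f = range (residue_class f)"
  by (auto simp: residue_classes_def residue_class_def quotient_def)

lemma bij_betw_representatives:
  assumes "degree f > 0"
  shows "bij_betw (residue_class f) (representatives f) (residue_classes f)"
proof (rule bij_betw_imageI)
  have eq: "residue_class f a = residue_class f b \<longleftrightarrow> a mod f = b mod f" for a b
    using eq_equiv_class_iff[OF equiv_cong_rel, of a b f]
    by (simp add: residue_class_def cong_rel_def cong_def)
  have red: "a mod f = a" if "a \<in> representatives f" for a
    using that by (auto simp: representatives_def mod_poly_less)
  show "inj_on (residue_class f) (representatives f)"
    by (rule inj_onI) (simp add: eq red)
  have "residue_class f a \<in> residue_class f ` representatives f" for a
  proof (rule image_eqI)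
    show "residue_class f a = residue_class f (a mod f)" by (simp add: eq)
    show "a mod f \<in> representatives f"
      using degree_mod_less[of f a] assms by (cases "f = 0") (auto simp: representatives_def)
  qed
  then show "residue_class f ` representatives f = residue_classes f"
    by (auto simp: residue_classes_eq_range)
qed

lemma reduce_residue_class:
  assumes "h dvd g"
  shows "reduce h (residue_class g a) = residue_class h a"
proof (rule set_eqI)
  fix x
  have "[a = b] (mod h)" if "[a = b] (mod g)" for b
    using that assms by (rule cong_dvd_modulus)
  then show "x \<in> reduce h (residue_class g a) \<longleftrightarrow> x \<in> residue_class h a"
    unfolding reduce_def residue_class_def cong_rel_def
    by (auto intro: cong_trans cong_refl)
qed

end

theory Submission
  imports Defs "HOL-Computational_Algebra.Polynomial_Factorial"
begin

text \<open>
  If some \<open>P i\<close> had degree below \<open>deg f\<close>, then \<open>0\<close> and \<open>P i\<close> would be distinct representatives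
  modulo \<open>f\<close> congruent modulo \<open>P i\<close>, which a function separating them by the values \<open>0\<close> and \<open>1\<close>
  does not respect. Conversely, a non-unit divisor \<open>h\<close> of \<open>g\<close> is a multiple of some \<open>P i\<close>, so if
  \<open>deg f \<le> deg (P i)\<close> then representatives congruent modulo \<open>h\<close> coincide, while a unit \<open>h\<close>
  imposes no condition.
\<close>

text \<open>Factors \<open>p\<close> cancel one at a time: if
  \<open>p * (p ^ n * m) = h * k\<close>, then \<open>p\<close> divides \<open>h * k\<close> but not
  \<open>h\<close>, hence divides \<open>k\<close>, and drops out of both sides.\<close>

lemma dvd_prime_elem_power_multD:
  fixes p :: "'a::algebraic_semidom"
  assumes "prime_elem p" and "\<not> p dvd h" and "h dvd p ^ n * m"
  shows "h dvd m"
  using assms(3)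
proof (induction n)
  case 0
  then show ?case by simp
next
  case (Suc n)
  then obtain k where k: "p * (p ^ n * m) = h * k"
    by (auto simp: mult.assoc elim: dvdE)
  then have "p dvd h * k"
    by (metis dvd_triv_left)
  then have "p dvd k"
    using assms(1,2) by (simp add: prime_elem_dvd_mult_iff)
  then obtain l where "k = p * l" ..
  with k have "p * (p ^ n * m) = p * (h * l)"
    by (simp add: ac_simps)
  then have "p ^ n * m = h * l"
    using assms(1) by (simp add: prime_elem_def)
  then show ?case
    using Suc.IH by simp
qed

text \<open>If no \<open>P i\<close> divided \<open>h\<close>, the prime powers could be stripped
  from the product one by one, leaving \<open>h dvd 1\<close>.\<close>

lemma prime_elem_dvd_of_dvd_prod_power:
  fixes P :: "'i \<Rightarrow> 'a::algebraic_semidom"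
  assumes "finite I" and "\<And>i. i \<in> I \<Longrightarrow> prime_elem (P i)"
    and "h dvd (\<Prod>i\<in>I. P i ^ e i)" and "\<not> is_unit h"
  shows "\<exists>i\<in>I. P i dvd h"
  using assms
  by (induction I rule: finite_induct) (auto dest: dvd_prime_elem_power_multD)

lemma residue_class_eq_iff: "residue_class f a = residue_class f b \<longleftrightarrow> [a = b] (mod f)"
  using eq_equiv_class_iff[OF equiv_cong_rel, of a b f]
  by (simp add: residue_class_def cong_rel_def)

text \<open>Both elements are already reduced modulo \<open>h\<close>, because \<open>h\<close> has
  at least the degree of \<open>f\<close>.\<close>

lemma representatives_eq_if_cong:
  assumes "a \<in> representatives f" and "b \<in> representatives f"
    and "degree f > 0" and "degree f \<le> degree h" and "[a = b] (mod h)"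
  shows "a = b"
proof -
  have "c mod h = c" if "c \<in> representatives f" for c
    using that assms(3,4) by (auto simp: representatives_def mod_poly_less)
  then show ?thesis
    using assms(1,2,5) by (simp add: cong_def)
qed

lemma congruence_preserving_if_degree_le:
  assumes "degree f > 0"
    and deg: "\<And>h. h dvd g \<Longrightarrow> \<not> is_unit h \<Longrightarrow> degree f \<le> degree h"
    and \<sigma>: "\<sigma> \<in> residue_classes f \<rightarrow> residue_classes g"
  shows "congruence_preserving f g \<sigma>"
  unfolding congruence_preserving_def
proof (intro ballI allI impI)
  fix h1 h2 h
  assume reps: "h1 \<in> representatives f" "h2 \<in> representatives f"
    and h: "h dvd g" and cong: "[h1 = h2] (mod h)"
  show "reduce h (\<sigma> (residue_class f h1)) = reduce h (\<sigma> (residue_class f h2))"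
  proof (cases "is_unit h")
    case True
    \<comment> \<open>Reduction modulo \<open>h\<close> is computed on a representative, so the
      values of \<open>\<sigma>\<close> must be genuine classes modulo \<open>g\<close>.\<close>
    have "\<exists>a. \<sigma> (residue_class f c) = residue_class g a" for c
      using \<sigma> by (auto simp: residue_classes_eq_range)
    moreover have "[a = b] (mod h)" for a b
      using True by (simp add: cong_iff_dvd_diff unit_imp_dvd)
    ultimately show ?thesis
      by (metis reduce_residue_class[OF h] residue_class_eq_iff)
  next
    case False
    then have "h1 = h2"
      using representatives_eq_if_cong reps assms(1) deg[OF h] cong by blast
    then show ?thesis by simp
  qed
qed

lemma ex_not_congruence_preserving:
  assumes "degree p < degree f" and "p dvd g" and "\<not> is_unit p" and "p \<noteq> 0"
  shows "\<exists>\<sigma> \<in> residue_classes f \<rightarrow> residue_classes g. \<not> congruence_preserving f g \<sigma>"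
proof
  let ?\<sigma> = "\<lambda>X. residue_class g (if X = residue_class f 0 then 0 else 1)"
  show "?\<sigma> \<in> residue_classes f \<rightarrow> residue_classes g"
    by (auto simp: residue_classes_eq_range)
  show "\<not> congruence_preserving f g ?\<sigma>"
  proof
    assume "congruence_preserving f g ?\<sigma>"
    moreover have reps: "0 \<in> representatives f" "p \<in> representatives f"
      using assms(1) by (auto simp: representatives_def)
    moreover have "[0 = p] (mod p)"
      by (simp add: cong_def)
    ultimately have "reduce p (?\<sigma> (residue_class f 0)) = reduce p (?\<sigma> (residue_class f p))"
      using assms(2) unfolding congruence_preserving_def by blast
    \<comment> \<open>As \<open>p\<close> is nonzero of degree below that of \<open>f\<close>, it is
      not a multiple of \<open>f\<close>; its class is therefore sent to the class of
      \<open>1\<close>.\<close>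
    moreover have "residue_class f p \<noteq> residue_class f 0"
      using assms(1,4) by (simp add: residue_class_eq_iff cong_def mod_poly_less)
    ultimately have "[0 = 1] (mod p)"
      by (simp add: reduce_residue_class[OF assms(2)] residue_class_eq_iff)
    then show False
      using assms(3) by (simp add: cong_iff_dvd_diff)
  qed
qed

theorem corollary1p6:
  fixes q r :: nat
    and f g :: "'a::{finite,field} poly"
    and \<alpha> :: 'a
    and P :: "nat \<Rightarrow> 'a poly"
    and e :: "nat \<Rightarrow> nat"
  assumes "primepow q" and "CARD('a) = q"
    and "degree f > 0" and "degree g > 0"
    and "\<alpha> \<noteq> 0"
    and "g = smult \<alpha> (\<Prod>i=1..r. P i ^ e i)"
    and "\<And>i. i \<in> {1..r} \<Longrightarrow> e i \<ge> 1"
    and "\<And>i. i \<in> {1..r} \<Longrightarrow> irreducible (P i) \<and> lead_coeff (P i) = 1 \<and> degree (P i) > 0"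
    and "inj_on P {1..r}"
  shows "(\<forall>\<sigma> \<in> residue_classes f \<rightarrow> residue_classes g. congruence_preserving f g \<sigma>)
    \<longleftrightarrow> (\<forall>i\<in>{1..r}. degree f \<le> degree (P i))"
proof
  assume all: "\<forall>\<sigma> \<in> residue_classes f \<rightarrow> residue_classes g. congruence_preserving f g \<sigma>"
  show "\<forall>i\<in>{1..r}. degree f \<le> degree (P i)"
  proof (rule ballI, rule ccontr)
    fix i assume i: "i \<in> {1..r}" and "\<not> degree f \<le> degree (P i)"
    have "P i dvd P i ^ e i"
      using assms(7)[OF i] by (simp add: dvd_power)
    also have "\<dots> dvd (\<Prod>i=1..r. P i ^ e i)"
      using i by (intro dvd_prodI) auto
    also have "\<dots> dvd g"
      unfolding assms(6) by (rule dvd_smult) simp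
    finally have "P i dvd g" .
    moreover have "\<not> is_unit (P i)" "P i \<noteq> 0"
      using assms(8)[OF i] by (auto simp: irreducible_def)
    ultimately show False
      using ex_not_congruence_preserving[of "P i" f g] all \<open>\<not> degree f \<le> degree (P i)\<close> by auto
  qed
next
  assume deg: "\<forall>i\<in>{1..r}. degree f \<le> degree (P i)"
  have "degree f \<le> degree h" if h: "h dvd g" "\<not> is_unit h" for h
  proof -
    \<comment> \<open>The nonzero constant \<open>\<alpha>\<close> is a unit and does not affect
      divisibility.\<close>
    have "h dvd (\<Prod>i=1..r. P i ^ e i)"
      using h(1) assms(5,6) by (simp add: dvd_smult_iff)
    moreover have "prime_elem (P i)" if "i \<in> {1..r}" for i
      using assms(8)[OF that] by (simp add: field_poly_irreducible_imp_prime)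
    ultimately obtain i where i: "i \<in> {1..r}" "P i dvd h"
      using prime_elem_dvd_of_dvd_prod_power[of "{1..r}" P h e] h(2) by blast
    \<comment> \<open>A divisor bounds the degree from below only for a nonzero multiple;
      \<open>h = 0\<close> would force \<open>g = 0\<close>, against
      \<open>degree g > 0\<close>.\<close>
    have "h \<noteq> 0"
      using h(1) assms(4) by auto
    with i deg show ?thesis
      using dvd_imp_degree_le by (meson order_trans)
  qed
  then show "\<forall>\<sigma> \<in> residue_classes f \<rightarrow> residue_classes g. congruence_preserving f g \<sigma>"
    using congruence_preserving_if_degree_le assms(3) by blast
qed

end
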